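(* For every integer $d\ge 2$ there are positive constants $\kappa_d,a_d$, depending only on $d$, such that for every positive real $R$, every $z\in\partial\mathbb{B}(0,2R)$, and every nonempty subset $V$ of the shell $\mathcal{S}=\mathbb{B}(0,2R)\setminus\mathbb{B}(0,R)$, writing $V^c=\mathcal{S}\setminus V$, $$P_z\big(H(\mathbb{B}(0,R))<H(V^c)\big)\le \exp\Big(a_d-\kappa_d\frac{R}{\rho}\Big),\qquad\text{where } \rho>0 \text{ is defined by } \rho^{\,d-1}=\frac{|V|}{R}.$$
   Context: Notation. $\|\cdot\|$ is the Euclidean norm; $\mathbb{B}(x,r)=\{y\in\mathbb{Z}^d:\|y-x\|<r\}$. For $\Lambda\subset\mathbb{Z}^d$, $|\Lambda|$ is the number of sites of $\Lambda$ and $\partial\Lambda=\{y\notin\Lambda:\exists x\in\Lambda,\ \|x-y\|=1\}$ (a subset of $\mathbb{Z}^d$). $P_z$ is the law of the discrete-time simple random walk $S$ on $\mathbb{Z}^d$ started at $z$, and $H(\Lambda)=\inf\{t\ge 0:S(t)\in\Lambda\}$ is the hitting time of $\Lambda$ (with $\inf\varnothing=+\infty$). *)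

theory Defs
  imports "HOL-Probability.Probability"
begin

text \<open>
  The lattice \<open>\<int>\<^sup>d\<close> is the type \<open>int ^ 'd\<close>, with \<open>d = CARD('d)\<close>.
\<close>

definition lattice_norm :: "int ^ 'd \<Rightarrow> real" where
  "lattice_norm x = norm (\<chi> i. real_of_int (x $ i))"

definition lattice_ball :: "int ^ 'd \<Rightarrow> real \<Rightarrow> (int ^ 'd) set" where
  "lattice_ball x r = {y. lattice_norm (y - x) < r}"

definition lattice_boundary :: "(int ^ 'd) set \<Rightarrow> (int ^ 'd) set" where
  "lattice_boundary \<Lambda> = {y. y \<notin> \<Lambda> \<and> (\<exists>x\<in>\<Lambda>. lattice_norm (x - y) = 1)}"

definition shell :: "real \<Rightarrow> (int ^ 'd) set" where
  "shell R = lattice_ball 0 (2 * R) - lattice_ball 0 R"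

definition step_pmf :: "(int ^ 'd) pmf" where
  "step_pmf = pmf_of_set {e. lattice_norm e = 1}"

definition srw_law :: "int ^ 'd \<Rightarrow> (nat \<Rightarrow> int ^ 'd) measure" where
  "srw_law z =
     distr (\<Pi>\<^sub>M i\<in>UNIV. measure_pmf step_pmf) (\<Pi>\<^sub>M t\<in>UNIV. count_space UNIV)
       (\<lambda>\<xi> t. z + (\<Sum>i<t. \<xi> i))"

text \<open>The infimum over the empty set is \<open>\<infinity>\<close>.\<close>

definition hitting_time :: "(int ^ 'd) set \<Rightarrow> (nat \<Rightarrow> int ^ 'd) \<Rightarrow> enat" where
  "hitting_time \<Lambda> S = (INF t\<in>{t. S t \<in> \<Lambda>}. enat t)"

text \<open>
  \<open>pmf_of_set\<close> is only meaningful for finite nonempty sets, \<open>distr\<close> for measurable maps and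
  \<open>measure\<close> for measurable sets; the following facts show that these side conditions hold.
\<close>

lemma finite_unit_steps: "finite {e :: int ^ 'd. lattice_norm e = 1}"
proof (rule finite_subset)
  show "{e :: int ^ 'd. lattice_norm e = 1} \<subseteq> vec_lambda ` (UNIV \<rightarrow>\<^sub>E {-1..1})"
  proof
    fix e :: "int ^ 'd" assume "e \<in> {e. lattice_norm e = 1}"
    hence n: "norm (\<chi> i. real_of_int (e $ i)) = 1" by (simp add: lattice_norm_def)
    have "e $ i \<in> {-1..1}" for i
      using component_le_norm_cart[of "\<chi> i. real_of_int (e $ i)" i] n by (simp, linarith)
    hence "vec_nth e \<in> UNIV \<rightarrow>\<^sub>E {-1..1}" by auto
    thus "e \<in> vec_lambda ` (UNIV \<rightarrow>\<^sub>E {-1..1})" by (metis image_eqI vec_nth_inverse)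
  qed
qed (intro finite_imageI finite_PiE; simp)

lemma unit_steps_nonempty: "{e :: int ^ 'd. lattice_norm e = 1} \<noteq> {}"
proof -
  have "(\<chi> i. real_of_int (axis k 1 $ i)) = (axis k 1 :: real ^ 'd)" for k :: 'd
    by (simp add: vec_eq_iff axis_def)
  hence "lattice_norm (axis k 1 :: int ^ 'd) = 1" for k
    by (simp add: lattice_norm_def norm_axis_1)
  thus ?thesis by blast
qed

lemma set_step_pmf: "set_pmf step_pmf = {e :: int ^ 'd. lattice_norm e = 1}"
  unfolding step_pmf_def by (rule set_pmf_of_set[OF unit_steps_nonempty finite_unit_steps])

lemma srw_path_measurable:
  "(\<lambda>\<xi> (t::nat). z + (\<Sum>i<t. \<xi> i))
     \<in> (\<Pi>\<^sub>M i\<in>UNIV. measure_pmf step_pmf) \<rightarrow>\<^sub>M (\<Pi>\<^sub>M t\<in>UNIV. count_space (UNIV :: (int ^ 'd) set))"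
proof -
  have inj: "inj (vec_nth :: int ^ 'd \<Rightarrow> _)" by (simp add: inj_def vec_eq_iff fun_eq_iff)
  have "countable (UNIV :: (int ^ 'd) set)"
    by (rule countableI'[of "to_nat \<circ> vec_nth"]) (use inj in \<open>auto intro!: inj_compose\<close>)
  have "(\<lambda>\<xi>. z + (\<Sum>i<t. \<xi> i))
     \<in> (\<Pi>\<^sub>M i\<in>(UNIV::nat set). measure_pmf step_pmf) \<rightarrow>\<^sub>M count_space (UNIV :: (int ^ 'd) set)" for t
  proof (induction t)
    case (Suc t)
    have "(\<lambda>\<xi>. \<xi> t) \<in> (\<Pi>\<^sub>M i\<in>(UNIV::nat set). measure_pmf step_pmf) \<rightarrow>\<^sub>M count_space (UNIV :: (int ^ 'd) set)"
      using measurable_component_singleton[of t UNIV "\<lambda>_. measure_pmf (step_pmf :: (int^'d) pmf)"]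
      by (simp cong: measurable_cong_sets)
    hence "(\<lambda>\<xi>. a + \<xi> t) \<in> (\<Pi>\<^sub>M i\<in>(UNIV::nat set). measure_pmf step_pmf) \<rightarrow>\<^sub>M count_space (UNIV :: (int ^ 'd) set)" for a
      by (rule measurable_compose) simp
    hence "(\<lambda>\<xi>. z + (\<Sum>i<t. \<xi> i) + \<xi> t)
       \<in> (\<Pi>\<^sub>M i\<in>(UNIV::nat set). measure_pmf step_pmf) \<rightarrow>\<^sub>M count_space (UNIV :: (int ^ 'd) set)"
      by (rule measurable_compose_countable'[OF _ Suc \<open>countable UNIV\<close>])
    thus ?case by (simp add: add.assoc)
  qed simp
  thus ?thesis by (intro measurable_PiM_single') auto
qed

lemma prob_space_srw_law: "prob_space (srw_law z)"
proof -
  interpret product_prob_space "\<lambda>_::nat. measure_pmf step_pmf" UNIV by unfold_locales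
  show ?thesis
    unfolding srw_law_def by (intro prob_space_distr srw_path_measurable)
qed

lemma hitting_time_less_iff:
  "hitting_time A S < hitting_time B S \<longleftrightarrow> (\<exists>t. S t \<in> A \<and> (\<forall>s\<le>t. S s \<notin> B))"
proof -
  have le: "hitting_time B S \<le> enat t \<longleftrightarrow> (\<exists>s\<le>t. S s \<in> B)" for t
  proof
    assume "hitting_time B S \<le> enat t"
    hence "(INF t\<in>{t. S t \<in> B}. enat t) < enat (Suc t)"
      unfolding hitting_time_def by (rule order_le_less_trans) simp
    thus "\<exists>s\<le>t. S s \<in> B" by (auto simp: INF_less_iff less_Suc_eq_le)
  qed (auto simp: hitting_time_def intro: INF_lower2)
  have "hitting_time A S < hitting_time B S \<longleftrightarrow> (\<exists>t. S t \<in> A \<and> enat t < hitting_time B S)"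
    by (subst hitting_time_def) (simp add: INF_less_iff)
  thus ?thesis using le by (metis not_le)
qed

lemma sets_hitting_time_less:
  "{S \<in> space (srw_law z). hitting_time A S < hitting_time B S} \<in> sets (srw_law z)"
proof -
  have [measurable]: "Measurable.pred (\<Pi>\<^sub>M t\<in>UNIV. count_space UNIV) (\<lambda>S. S t \<in> C)" for t :: nat and C :: "(int ^ 'd) set"
    by (rule measurable_compose[OF measurable_component_singleton]) auto
  show ?thesis
    unfolding hitting_time_less_iff srw_law_def sets_distr space_distr by measurable
qed

end

theory Submission
  imports Defs
begin

text \<open>
  The shell is cut into annuli of thickness \<open>3r\<close>, with \<open>r\<close> a large multiple of \<open>\<rho>\<close> (or a
  large constant when \<open>\<rho>\<close> is small), and the walk has to cross all of them to reach
  \<open>B(0,R)\<close>. Because \<open>|V| = R \<rho>\<^sup>d\<^sup>-\<^sup>1\<close>, a fixed fraction of these annuli, whose number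
  is of order \<open>R / r\<close>, contain only a small multiple of \<open>r\<^sup>d\<close> sites of \<open>V\<close>
  (\<open>many_uncrowded_sub_annuli\<close>). Each such annulus costs a factor \<open>1/2\<close>
  (\<open>hit_prob_across_annulus\<close>), which gives an exponential in \<open>R / r\<close>, that is in
  \<open>R / \<rho>\<close>. If \<open>\<rho>\<close> is so small that \<open>r\<close> is a constant, a sparse annulus is free of
  \<open>V\<close> and cannot be crossed at all.

  The cost of an annulus comes from a comparison of time scales. Stop the walk midway through the
  annulus at a site \<open>x\<close>, and let \<open>\<tau>\<close> be the time it then takes to leave the part of \<open>V\<close> in
  the annulus. Up to time \<open>\<tau>\<close> the mean of \<open>\<parallel>S - x\<parallel>\<^sup>2\<close> grows by one per step, so leaving the
  ball \<open>B(x,r)\<close> before stepping off \<open>V\<close> has probability at most \<open>E \<tau> / r\<^sup>2\<close>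
  (\<open>hit_prob_le_exit_time\<close>). On the other hand the expected exit time of a set of \<open>m\<close> sites is
  at most a constant times \<open>m\<^sup>2\<^sup>/\<^sup>d\<close>, whatever its shape and whatever the starting point
  (\<open>truncated_exit_time_le\<close>); for few enough sites this is below \<open>r\<^sup>2 / 2\<close>.

  The bound on the exit time is a level set argument. The expected exit time \<open>u\<close> satisfies
  \<open>u \<le> 1 + P u\<close> on the set, where \<open>P\<close> averages over the neighbours; hence each excess
  \<open>(u - k)\<^sup>+\<close> has Dirichlet energy at most a constant times its own sum. A Nash inequality
  (\<open>nash_inequality\<close>) turns this into a bound of the excess by the number of sites where it is
  positive (\<open>sum_excess_le\<close>), so that the level sets of \<open>u\<close> shrink by a factor \<open>2\<^sup>d\<close>
  each time the level rises by a multiple of \<open>m\<^sup>2\<^sup>/\<^sup>d\<close>, \<open>m\<close> being the current number of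
  sites. These rises form a geometric series (\<open>subsolution_bound\<close>).

  All probabilities are taken over a finite time horizon first. They then obey one-step
  recursions, and the strong Markov property and optional stopping become inductions on the horizon.
\<close>

section \<open>Unit steps and means over neighbours\<close>

definition unit_steps :: "(int ^ 'd) set" where
  "unit_steps = {e. lattice_norm e = 1}"

definition neighbour_mean :: "(int ^ 'd::finite \<Rightarrow> real) \<Rightarrow> int ^ 'd \<Rightarrow> real" where
  "neighbour_mean u y = (\<Sum>e\<in>unit_steps. u (y + e)) / real (card (unit_steps :: (int ^ 'd) set))"

lemma finite_steps [simp]: "finite (unit_steps :: (int ^ 'd::finite) set)"
  unfolding unit_steps_def by (rule finite_unit_steps)

lemma card_unit_steps_pos: "card (unit_steps :: (int ^ 'd::finite) set) > 0"
  unfolding unit_steps_def using unit_steps_nonempty finite_unit_steps by (simp add: card_gt_0_iff)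

lemma axis_in_unit_steps: "axis i 1 \<in> (unit_steps :: (int ^ 'd::finite) set)"
proof -
  have "(\<chi> j. real_of_int (axis i 1 $ j)) = (axis i 1 :: real ^ 'd)"
    by (simp add: vec_eq_iff axis_def)
  thus ?thesis by (simp add: unit_steps_def lattice_norm_def norm_axis_1)
qed

lemma steps_nonempty [simp]: "unit_steps \<noteq> ({} :: (int ^ 'd::finite) set)"
  using axis_in_unit_steps by blast

lemma neighbour_mean_mono:
  "(\<And>e. e \<in> unit_steps \<Longrightarrow> u (y + e) \<le> w (y + e)) \<Longrightarrow> neighbour_mean u y \<le> neighbour_mean w y"
  unfolding neighbour_mean_def by (intro divide_right_mono sum_mono) auto

lemma neighbour_mean_affine:
  fixes y :: "int ^ 'd::finite"
  shows
  "neighbour_mean (\<lambda>x. a * u x + b * w x + c) y = a * neighbour_mean u y + b * neighbour_mean w y + c"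
  using card_unit_steps_pos[where 'd='d]
  by (simp add: neighbour_mean_def sum.distrib add_divide_distrib flip: sum_distrib_left)

lemma neighbour_mean_const [simp]: "neighbour_mean (\<lambda>x. c) y = c"
  using neighbour_mean_affine[of 0 "\<lambda>_. 0" 0 "\<lambda>_. 0" c y] by simp

lemma neighbour_mean_le_const:
  "(\<And>e. e \<in> unit_steps \<Longrightarrow> u (y + e) \<le> c) \<Longrightarrow> neighbour_mean u y \<le> c"
  using neighbour_mean_mono[where u = u and w = "\<lambda>_. c" and y = y] by simp

section \<open>Increment energies and a Nash inequality\<close>

text \<open>
  For a unit step \<open>v\<close> this is the part of the Dirichlet energy of \<open>f\<close> carried by the edges in
  direction \<open>v\<close>. Sums over the whole lattice make it invariant under translation; every function
  to which it is applied below has finite support.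
\<close>

definition increment_energy :: "('a::ab_group_add \<Rightarrow> real) \<Rightarrow> 'a \<Rightarrow> real" where
  "increment_energy f v = (\<Sum>\<^sub>\<infinity>y. (f y - f (y + v))\<^sup>2)"

lemma infsum_finite_support:
  fixes f :: "'a \<Rightarrow> real"
  assumes "finite F" "\<And>x. x \<notin> F \<Longrightarrow> f x = 0"
  shows "infsum f UNIV = sum f F"
  using infsum_cong_neutral[of F UNIV f f] assms by auto

lemma infsum_translate:
  fixes f :: "'a::ab_group_add \<Rightarrow> real"
  shows "(\<Sum>\<^sub>\<infinity>y. f (y + v)) = infsum f UNIV"
  by (rule infsum_reindex_bij_betw)
     (rule bij_betw_byWitness[where f' = "\<lambda>y. y - v"], auto)

lemma sum_translate_le:
  fixes f :: "'a::ab_group_add \<Rightarrow> real"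
  assumes "finite U" "\<And>x. x \<notin> U \<Longrightarrow> f x = 0" "\<And>x. f x \<ge> 0" "finite F"
  shows "(\<Sum>y\<in>F. f (y + v)) \<le> sum f U"
proof -
  have "(\<Sum>y\<in>F. f (y + v)) = sum f ((\<lambda>y. y + v) ` F)"
    by (subst sum.reindex) (auto simp: inj_on_def)
  also have "\<dots> = sum f (((\<lambda>y. y + v) ` F) \<inter> U)"
    using assms by (intro sum.mono_neutral_right) auto
  also have "\<dots> \<le> sum f U"
    using assms by (intro sum_mono2) auto
  finally show ?thesis .
qed

lemma increment_energy_eq_sum:
  fixes f :: "'a::ab_group_add \<Rightarrow> real"
  assumes "finite F" "U \<union> (\<lambda>y. y - v) ` U \<subseteq> F" "\<And>x. x \<notin> U \<Longrightarrow> f x = 0"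
  shows "increment_energy f v = (\<Sum>y\<in>F. (f y - f (y + v))\<^sup>2)"
  unfolding increment_energy_def
proof (rule infsum_finite_support[OF assms(1)])
  fix x assume "x \<notin> F"
  hence "x \<notin> U" "x + v \<notin> U" using assms(2) by (auto simp: image_iff)
  thus "(f x - f (x + v))\<^sup>2 = 0" using assms(3) by simp
qed

lemma increment_energy_nonneg: "increment_energy f v \<ge> 0"
  unfolding increment_energy_def by (rule infsum_nonneg) simp

lemma increment_energy_zero [simp]: "increment_energy f 0 = 0"
  by (simp add: increment_energy_def)

text \<open>
  Expanding the square: by translation invariance both quadratic terms sum to \<open>\<parallel>f\<parallel>\<^sub>2\<^sup>2\<close>.
\<close>

lemma increment_energy_eq_correlation:
  fixes f :: "'a::ab_group_add \<Rightarrow> real"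
  assumes U: "finite U" "\<And>x. x \<notin> U \<Longrightarrow> f x = 0"
  shows "increment_energy f v = 2 * (\<Sum>y\<in>U. (f y)\<^sup>2) - 2 * (\<Sum>y\<in>U. f y * f (y + v))"
proof -
  define F where "F = U \<union> (\<lambda>y. y - v) ` U"
  have F: "finite F" "U \<subseteq> F" using U by (auto simp: F_def)
  have trans: "(\<Sum>y\<in>F. (f (y + v))\<^sup>2) = (\<Sum>y\<in>U. (f y)\<^sup>2)"
  proof -
    have "(\<Sum>y\<in>F. (f (y + v))\<^sup>2) = (\<Sum>\<^sub>\<infinity>y. (f (y + v))\<^sup>2)"
      using F U by (intro infsum_finite_support[symmetric]) (auto simp: F_def image_iff eq_diff_eq)
    also have "\<dots> = (\<Sum>\<^sub>\<infinity>y. (f y)\<^sup>2)" by (rule infsum_translate)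
    also have "\<dots> = (\<Sum>y\<in>U. (f y)\<^sup>2)" using U by (intro infsum_finite_support) auto
    finally show ?thesis .
  qed
  have "increment_energy f v = (\<Sum>y\<in>F. (f y)\<^sup>2 + (f (y + v))\<^sup>2 - 2 * (f y * f (y + v)))"
    by (subst increment_energy_eq_sum[of F U])
       (use F U in \<open>auto simp: F_def power2_eq_square algebra_simps\<close>)
  also have "\<dots> = (\<Sum>y\<in>F. (f y)\<^sup>2) + (\<Sum>y\<in>F. (f (y + v))\<^sup>2) - 2 * (\<Sum>y\<in>F. f y * f (y + v))"
    by (simp add: sum.distrib sum_subtractf sum_distrib_left)
  also have "(\<Sum>y\<in>F. (f y)\<^sup>2) = (\<Sum>y\<in>U. (f y)\<^sup>2)"
    using F U by (intro sum.mono_neutral_right) auto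
  also have "(\<Sum>y\<in>F. f y * f (y + v)) = (\<Sum>y\<in>U. f y * f (y + v))"
    using F U by (intro sum.mono_neutral_right) auto
  finally show ?thesis using trans by simp
qed

text \<open>
  The root of the energy is the \<open>L\<^sup>2\<close> norm of \<open>f - f(\<cdot> + v)\<close>, and the increment by
  \<open>v + w\<close> is the increment by \<open>v\<close> plus a translate of the increment by \<open>w\<close>.
\<close>

lemma sqrt_increment_energy_add:
  fixes f :: "'a::ab_group_add \<Rightarrow> real"
  assumes U: "finite U" "\<And>x. x \<notin> U \<Longrightarrow> f x = 0"
  shows "sqrt (increment_energy f (v + w)) \<le> sqrt (increment_energy f v) + sqrt (increment_energy f w)"
proof -
  define F where "F = U \<union> (\<lambda>y. y - v) ` U \<union> (\<lambda>y. y - (v + w)) ` U"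
  have F: "finite F" using U by (auto simp: F_def)
  define G where "G = U \<union> (\<lambda>y. y - w) ` U"
  have G: "finite G" using U by (auto simp: G_def)
  have "sqrt (increment_energy f (v + w)) = L2_set (\<lambda>y. (f y - f (y + v)) + (f (y + v) - f (y + v + w))) F"
    unfolding L2_set_def
    by (subst increment_energy_eq_sum[of F U]) (use F U in \<open>auto simp: F_def add.assoc\<close>)
  also have "\<dots> \<le> L2_set (\<lambda>y. f y - f (y + v)) F + L2_set (\<lambda>y. f (y + v) - f (y + v + w)) F"
    by (rule L2_set_triangle_ineq)
  also have "L2_set (\<lambda>y. f y - f (y + v)) F = sqrt (increment_energy f v)"
    unfolding L2_set_def
    by (subst increment_energy_eq_sum[of F U]) (use F U in \<open>auto simp: F_def\<close>)
  also have "L2_set (\<lambda>y. f (y + v) - f (y + v + w)) F \<le> sqrt (increment_energy f w)"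
  proof -
    have "(\<Sum>y\<in>F. (f (y + v) - f (y + v + w))\<^sup>2) \<le> (\<Sum>y\<in>G. (f y - f (y + w))\<^sup>2)"
      by (rule sum_translate_le[of G "\<lambda>y. (f y - f (y + w))\<^sup>2" F v])
         (use F G U in \<open>auto simp: G_def image_iff eq_diff_eq\<close>)
    also have "\<dots> = increment_energy f w"
      by (subst increment_energy_eq_sum[of G U]) (use G U in \<open>auto simp: G_def\<close>)
    finally show ?thesis unfolding L2_set_def by simp
  qed
  finally show ?thesis by simp
qed

text \<open>
  A path of unit steps leads from \<open>0\<close> to \<open>v\<close> and has as many steps as the sum of the
  coordinates of \<open>v\<close>; the triangle inequality is applied along it.
\<close>

lemma sqrt_increment_energy_le_l1:
  fixes f :: "int ^ 'd::finite \<Rightarrow> real"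
  assumes U: "finite U" "\<And>x. x \<notin> U \<Longrightarrow> f x = 0"
    and unit: "\<And>i. sqrt (increment_energy f (axis i 1)) \<le> \<delta>"
    and v: "\<And>i. v $ i \<ge> 0"
  shows "sqrt (increment_energy f v) \<le> (\<Sum>i\<in>UNIV. real_of_int (v $ i)) * \<delta>"
proof -
  have add: "sqrt (increment_energy f (v + w))
      \<le> sqrt (increment_energy f v) + sqrt (increment_energy f w)" for v w
    by (rule sqrt_increment_energy_add) (use U in auto)
  have one: "sqrt (increment_energy f (axis i (int n))) \<le> real n * \<delta>" for i n
  proof (induction n)
    case 0
    have "axis i (int 0) = (0 :: int ^ 'd)" by (simp add: axis_def vec_eq_iff)
    thus ?case by (simp only: increment_energy_zero) simp
  next
    case (Suc n)
    have "axis i (int (Suc n)) = axis i (int n) + axis i 1"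
      by (simp add: axis_def vec_eq_iff)
    thus ?case
      using add[of "axis i (int n)" "axis i 1"] Suc unit[of i]
      by (simp add: algebra_simps)
  qed
  have "sqrt (increment_energy f (\<Sum>i\<in>I. axis i (v $ i))) \<le> (\<Sum>i\<in>I. real_of_int (v $ i)) * \<delta>"
    if "finite I" for I
    using that
  proof (induction I rule: finite_induct)
    case (insert i I)
    have "sqrt (increment_energy f (axis i (v $ i))) \<le> real_of_int (v $ i) * \<delta>"
      using one[of i "nat (v $ i)"] v[of i] by simp
    thus ?case
      using add[of "axis i (v $ i)" "\<Sum>i\<in>I. axis i (v $ i)"] insert
      by (simp add: algebra_simps)
  qed simp
  moreover have "(\<Sum>i\<in>UNIV. axis i (v $ i)) = v"
    by (simp add: vec_eq_iff axis_def)
  ultimately show ?thesis by (metis finite)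
qed

definition corner_box :: "nat \<Rightarrow> (int ^ 'd) set" where
  "corner_box L = {v. \<forall>i. 0 \<le> v $ i \<and> v $ i < int L}"

lemma corner_box_eq_image:
  "(corner_box L :: (int ^ 'd::finite) set) = vec_lambda ` (UNIV \<rightarrow>\<^sub>E {0..<int L})"
proof
  show "(corner_box L :: (int ^ 'd) set) \<subseteq> vec_lambda ` (UNIV \<rightarrow>\<^sub>E {0..<int L})"
  proof
    fix v :: "int ^ 'd" assume "v \<in> corner_box L"
    hence "vec_nth v \<in> UNIV \<rightarrow>\<^sub>E {0..<int L}" by (auto simp: corner_box_def)
    thus "v \<in> vec_lambda ` (UNIV \<rightarrow>\<^sub>E {0..<int L})" by (metis image_eqI vec_nth_inverse)
  qed
qed (auto simp: corner_box_def PiE_iff)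

lemma finite_corner_box [simp]: "finite (corner_box L :: (int ^ 'd::finite) set)"
  unfolding corner_box_eq_image by (intro finite_imageI finite_PiE) auto

lemma card_corner_box: "card (corner_box L :: (int ^ 'd::finite) set) = L ^ CARD('d)"
  unfolding corner_box_eq_image
  by (subst card_image) (auto simp: inj_on_def vec_lambda_inject card_PiE)

text \<open>
  Average the energy \<open>2 \<parallel>f\<parallel>\<^sub>2\<^sup>2 - 2 \<langle>f, f(\<cdot> + v)\<rangle>\<close> over the \<open>L\<^sup>d\<close> displacements
  \<open>v\<close> in a box of side \<open>L\<close>. Distinct displacements reach distinct sites, so the correlation
  terms add up to at most \<open>\<parallel>f\<parallel>\<^sub>1\<^sup>2\<close>, while each energy is controlled by unit steps along a
  path of length at most \<open>d L\<close>. The free parameter \<open>L\<close> balances the two terms.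
\<close>

lemma nash_inequality:
  fixes f :: "int ^ 'd::finite \<Rightarrow> real"
  assumes U: "finite U" "\<And>x. x \<notin> U \<Longrightarrow> f x = 0" and f: "\<And>x. f x \<ge> 0"
    and unit: "\<And>i. increment_energy f (axis i 1) \<le> D" and L: "L > 0"
  shows "(\<Sum>y\<in>U. (f y)\<^sup>2) \<le> (\<Sum>y\<in>U. f y)\<^sup>2 / real L ^ CARD('d) + (real CARD('d) * real L)\<^sup>2 * D / 2"
proof -
  let ?B = "corner_box L :: (int ^ 'd) set" and ?n = "real L ^ CARD('d)"
  have D: "D \<ge> 0" using increment_energy_nonneg unit by (metis order_trans)
  have bound: "increment_energy f v \<le> (real CARD('d) * real L)\<^sup>2 * D" if "v \<in> ?B" for v
  proof -
    have v: "0 \<le> v $ i" "v $ i < int L" for i using that by (auto simp: corner_box_def)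
    have "sqrt (increment_energy f v) \<le> (\<Sum>i\<in>UNIV. real_of_int (v $ i)) * sqrt D"
      by (rule sqrt_increment_energy_le_l1[OF U]) (use unit v in auto)
    also have "(\<Sum>i\<in>UNIV. real_of_int (v $ i)) \<le> (\<Sum>i\<in>(UNIV::'d set). real L)"
      by (intro sum_mono) (use v in \<open>simp add: less_imp_le\<close>, smt (verit) of_int_of_nat_eq of_int_le_iff)
    finally have "sqrt (increment_energy f v) \<le> real CARD('d) * real L * sqrt D"
      using D by (simp add: mult_right_mono)
    hence "(sqrt (increment_energy f v))\<^sup>2 \<le> (real CARD('d) * real L * sqrt D)\<^sup>2"
      by (intro power_mono) (auto simp: increment_energy_nonneg)
    thus ?thesis using D increment_energy_nonneg[of f v] by (simp add: power_mult_distrib)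
  qed
  have "(\<Sum>v\<in>?B. increment_energy f v)
      = 2 * ?n * (\<Sum>y\<in>U. (f y)\<^sup>2) - 2 * (\<Sum>v\<in>?B. \<Sum>y\<in>U. f y * f (y + v))"
    by (simp add: increment_energy_eq_correlation[OF U] sum_subtractf card_corner_box
        flip: sum_distrib_left)
  also have "(\<Sum>v\<in>?B. \<Sum>y\<in>U. f y * f (y + v)) = (\<Sum>y\<in>U. f y * (\<Sum>v\<in>?B. f (v + y)))"
    by (subst sum.swap) (simp add: sum_distrib_left add.commute)
  finally have eq: "(\<Sum>v\<in>?B. increment_energy f v)
      = 2 * ?n * (\<Sum>y\<in>U. (f y)\<^sup>2) - 2 * (\<Sum>y\<in>U. f y * (\<Sum>v\<in>?B. f (v + y)))" .
  have "(\<Sum>y\<in>U. f y * (\<Sum>v\<in>?B. f (v + y))) \<le> (\<Sum>y\<in>U. f y * (\<Sum>x\<in>U. f x))"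
    by (intro sum_mono mult_left_mono sum_translate_le) (use U f in auto)
  also have "\<dots> = (\<Sum>y\<in>U. f y)\<^sup>2" by (simp add: power2_eq_square sum_distrib_right)
  finally have cross: "(\<Sum>y\<in>U. f y * (\<Sum>v\<in>?B. f (v + y))) \<le> (\<Sum>y\<in>U. f y)\<^sup>2" .
  have "(\<Sum>v\<in>?B. increment_energy f v) \<le> ?n * ((real CARD('d) * real L)\<^sup>2 * D)"
    using sum_bounded_above[of ?B "increment_energy f", OF bound] by (simp add: card_corner_box)
  with eq cross have "2 * ?n * (\<Sum>y\<in>U. (f y)\<^sup>2)
      \<le> ?n * ((real CARD('d) * real L)\<^sup>2 * D) + 2 * (\<Sum>y\<in>U. f y)\<^sup>2" by linarith
  thus ?thesis using L by (simp add: field_simps)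
qed

section \<open>Expected exit times of small sets\<close>

text \<open>
  Summation by parts: the energies of all unit steps together equal
  \<open>2 q \<langle>g, g - P g\<rangle>\<close>, where \<open>P\<close> is the mean over the \<open>q\<close> neighbours. One energy
  is at most their sum.
\<close>

lemma increment_energy_le_of_subsolution:
  fixes g :: "int ^ 'd::finite \<Rightarrow> real"
  assumes U: "finite U" "\<And>x. x \<notin> U \<Longrightarrow> g x = 0" and g: "\<And>x. g x \<ge> 0"
    and sub: "\<And>y. y \<in> U \<Longrightarrow> g y \<le> 1 + neighbour_mean g y"
    and e: "e \<in> unit_steps"
  shows "increment_energy g e \<le> 2 * real (card (unit_steps :: (int ^ 'd) set)) * (\<Sum>y\<in>U. g y)"
proof -
  let ?E = "unit_steps :: (int ^ 'd) set"
  let ?q = "real (card ?E)"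
  have "increment_energy g e \<le> (\<Sum>e\<in>?E. increment_energy g e)"
    by (rule member_le_sum) (use e in \<open>auto simp: increment_energy_nonneg\<close>)
  also have "\<dots> = 2 * ?q * (\<Sum>y\<in>U. (g y)\<^sup>2) - 2 * (\<Sum>e\<in>?E. \<Sum>y\<in>U. g y * g (y + e))"
    by (simp add: increment_energy_eq_correlation[OF U] sum_subtractf flip: sum_distrib_left)
  also have "(\<Sum>e\<in>?E. \<Sum>y\<in>U. g y * g (y + e)) = (\<Sum>y\<in>U. g y * (?q * neighbour_mean g y))"
    by (subst sum.swap) (simp add: neighbour_mean_def flip: sum_distrib_left)
  also have "2 * ?q * (\<Sum>y\<in>U. (g y)\<^sup>2) - 2 * (\<Sum>y\<in>U. g y * (?q * neighbour_mean g y))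
      = 2 * ?q * (\<Sum>y\<in>U. g y * (g y - neighbour_mean g y))"
    by (simp add: sum_distrib_left sum_subtractf power2_eq_square algebra_simps)
  also have "\<dots> \<le> 2 * ?q * (\<Sum>y\<in>U. g y * 1)"
    by (intro mult_left_mono sum_mono) (use g sub in \<open>auto simp: algebra_simps\<close>)
  finally show ?thesis by simp
qed

text \<open>
  The excess over a level is again a subsolution, so its energy is bounded by a multiple of its own sum
  \<open>s\<close>. With \<open>m\<close> the number of sites above the level, the Cauchy-Schwarz inequality gives
  \<open>s\<^sup>2 \<le> m \<parallel>g\<parallel>\<^sub>2\<^sup>2\<close>. In the Nash inequality the term \<open>m s\<^sup>2 / L\<^sup>d\<close> is at most
  \<open>s\<^sup>2 / 2\<close> by the choice of \<open>L\<close> and is absorbed on the left; what remains is linear in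
  \<open>s\<close> on the right.
\<close>

lemma sum_excess_le:
  fixes u :: "int ^ 'd::finite \<Rightarrow> real"
  assumes W: "finite W" "\<And>x. x \<notin> W \<Longrightarrow> u x = 0"
    and sub: "\<And>y. y \<in> W \<Longrightarrow> u y \<le> 1 + neighbour_mean u y"
    and k: "k \<ge> 0" and L: "L > 0" "2 * card {y. u y > k} \<le> L ^ CARD('d)"
  defines "q \<equiv> real (card (unit_steps :: (int ^ 'd) set))" and "d \<equiv> real CARD('d)"
  shows "(\<Sum>y\<in>{y. u y > k}. u y - k) \<le> 2 * d\<^sup>2 * q * (real L)\<^sup>2 * real (card {y. u y > k})"
proof -
  define U where "U = {y. u y > k}"
  define g where "g = (\<lambda>y. max 0 (u y - k))"
  define s where "s = (\<Sum>y\<in>U. g y)"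
  have "U \<subseteq> W" using W k by (force simp: U_def)
  hence U: "finite U" using W finite_subset by blast
  have gU: "g x = 0" if "x \<notin> U" for x using that by (auto simp: g_def U_def)
  have g: "g x \<ge> 0" for x by (simp add: g_def)
  have subg: "g y \<le> 1 + neighbour_mean g y" if "y \<in> U" for y
  proof -
    \<comment> \<open>The shape of this affine combination matches \<open>neighbour_mean_affine\<close>.\<close>
    have "neighbour_mean u y \<le> neighbour_mean (\<lambda>x. 1 * g x + 0 * g x + k) y"
      by (rule neighbour_mean_mono) (auto simp: g_def)
    also have "\<dots> = neighbour_mean g y + k" by (subst neighbour_mean_affine) simp
    finally show ?thesis using sub[of y] that \<open>U \<subseteq> W\<close> by (auto simp: g_def U_def)
  qed
  have "(\<Sum>y\<in>U. (g y)\<^sup>2) \<le> s\<^sup>2 / real L ^ CARD('d) + (d * real L)\<^sup>2 * (2 * q * s) / 2"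
    unfolding s_def d_def q_def
  proof (rule nash_inequality[OF U])
    fix i :: 'd
    show "increment_energy g (axis i 1) \<le> 2 * real (card (unit_steps :: (int ^ 'd) set)) * sum g U"
      by (rule increment_energy_le_of_subsolution[OF U]) (auto simp: gU g subg axis_in_unit_steps)
  qed (use gU g L(1) in auto)
  also have "\<dots> = s\<^sup>2 / real L ^ CARD('d) + d\<^sup>2 * q * (real L)\<^sup>2 * s"
    by (simp add: power_mult_distrib)
  finally have nash: "(\<Sum>y\<in>U. (g y)\<^sup>2) \<le> s\<^sup>2 / real L ^ CARD('d) + d\<^sup>2 * q * (real L)\<^sup>2 * s" .
  have cs: "s\<^sup>2 \<le> real (card U) * (\<Sum>y\<in>U. (g y)\<^sup>2)"
    using Cauchy_Schwarz_ineq_sum[of "\<lambda>_. 1" g U] by (simp add: s_def)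
  have s0: "s \<ge> 0" unfolding s_def by (intro sum_nonneg g)
  have half: "real (card U) * (s\<^sup>2 / real L ^ CARD('d)) \<le> s\<^sup>2 / 2"
  proof -
    have "2 * real (card U) \<le> real L ^ CARD('d)"
      using L(2) unfolding U_def of_nat_le_iff[where 'a = real, symmetric] by simp
    hence "2 * real (card U) * s\<^sup>2 \<le> real L ^ CARD('d) * s\<^sup>2" by (rule mult_right_mono) simp
    thus ?thesis using L(1) by (simp add: field_simps)
  qed
  have "s * s \<le> (2 * d\<^sup>2 * q * (real L)\<^sup>2 * real (card U)) * s"
  proof -
    have "real (card U) * (\<Sum>y\<in>U. (g y)\<^sup>2)
        \<le> real (card U) * (s\<^sup>2 / real L ^ CARD('d) + d\<^sup>2 * q * (real L)\<^sup>2 * s)"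
      using nash by (intro mult_left_mono) auto
    with cs half have "s\<^sup>2 \<le> s\<^sup>2 / 2 + real (card U) * (d\<^sup>2 * q * (real L)\<^sup>2 * s)"
      unfolding distrib_left by linarith
    thus ?thesis by (simp add: power2_eq_square algebra_simps)
  qed
  hence "s \<le> 2 * d\<^sup>2 * q * (real L)\<^sup>2 * real (card U)"
    using s0 by (cases "s = 0") (auto simp: q_def d_def)
  moreover have "s = (\<Sum>y\<in>U. u y - k)"
    unfolding s_def by (rule sum.cong) (auto simp: g_def U_def)
  ultimately show ?thesis by (simp add: U_def)
qed

text \<open>
  The maximal expected exit time of a set is the maximum of its torsion function. This constant
  bounds it by \<open>torsion_const \<cdot> 4\<^sup>j\<close> for sets of at most \<open>2\<^sup>j\<^sup>d / 2\<close> sites.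
\<close>

definition torsion_const :: "'d::finite itself \<Rightarrow> real" where
  "torsion_const _ = 2 ^ (CARD('d) + 2) * (real CARD('d))\<^sup>2 * real (card (unit_steps :: (int ^ 'd) set))"

lemma torsion_const_ge_1: "torsion_const TYPE('d::finite) \<ge> 1"
proof -
  have "real CARD('d) \<ge> 1" by (simp add: Suc_le_eq)
  moreover have "real (card (unit_steps :: (int ^ 'd) set)) \<ge> 1"
    using card_unit_steps_pos[where 'd='d] by linarith
  moreover have "(2::real) ^ (CARD('d) + 2) \<ge> 1" by (rule one_le_power) simp
  ultimately have "1 * 1 * 1 \<le> torsion_const TYPE('d)"
    unfolding torsion_const_def by (intro mult_mono one_le_power) auto
  thus ?thesis by simp
qed

text \<open>
  Raising the level by \<open>h\<close>, half of the claimed bound at scale \<open>j\<close>, divides the number of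
  sites above it by \<open>2\<^sup>d\<close>: each of the remaining sites has excess at least \<open>h\<close> over the old level,
  and the total excess is bounded by \<open>sum_excess_le\<close> with \<open>L = 2\<^sup>j\<close>. This is scale
  \<open>j - 1\<close>, where the bound is a quarter as large. At scale \<open>0\<close> less than one site is left.
\<close>

lemma subsolution_bound:
  fixes u :: "int ^ 'd::finite \<Rightarrow> real"
  assumes W: "finite W" "\<And>x. x \<notin> W \<Longrightarrow> u x = 0"
    and sub: "\<And>y. y \<in> W \<Longrightarrow> u y \<le> 1 + neighbour_mean u y"
    and k: "k \<ge> 0" and small: "2 * card {y. u y > k} \<le> 2 ^ (j * CARD('d))"
  shows "u y \<le> k + torsion_const TYPE('d) * 4 ^ j"
  using k small
proof (induction j arbitrary: k)
  case 0
  have "{y. u y > k} \<subseteq> W" by (metis W(2) 0(1) mem_Collect_eq not_less subsetI)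
  hence "finite {y. u y > k}" using W finite_subset by blast
  moreover have "card {y. u y > k} = 0" using 0 by simp
  ultimately have "{y. u y > k} = {}" by (simp only: card_0_eq)
  hence "u y \<le> k" by (auto simp: not_less)
  thus ?case using torsion_const_ge_1[where 'd='d] by simp
next
  case (Suc j)
  let ?q = "real (card (unit_steps :: (int ^ 'd) set))" and ?d = "real CARD('d)"
  let ?K = "torsion_const TYPE('d)"
  define h where "h = ?K * 4 ^ Suc j / 2"
  have h: "h > 0" using torsion_const_ge_1[where 'd='d] by (simp add: h_def)
  have fin: "finite {y. u y > k'}" if "k' \<ge> 0" for k'
    by (rule finite_subset[OF _ W(1)]) (metis W(2) that mem_Collect_eq not_less subsetI)
  let ?m = "real (card {y. u y > k})" and ?m' = "real (card {y. u y > k + h})"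
  have "h * ?m' \<le> (\<Sum>y\<in>{y. u y > k + h}. u y - k)"
    using sum_bounded_below[of "{y. u y > k + h}" h "\<lambda>y. u y - k"] by (simp add: mult.commute)
  also have "\<dots> \<le> (\<Sum>y\<in>{y. u y > k}. u y - k)"
    by (rule sum_mono2) (use fin Suc.prems h in auto)
  also have "\<dots> \<le> 2 * ?d\<^sup>2 * ?q * (real (2 ^ Suc j))\<^sup>2 * ?m"
  proof (rule sum_excess_le[OF W sub])
    show "2 * card {y. k < u y} \<le> (2 ^ Suc j) ^ CARD('d)"
      using Suc.prems(2) by (simp only: power_mult)
    show "0 \<le> k" by (rule Suc.prems)
    show "0 < (2::nat) ^ Suc j" by simp
  qed
  also have "(real (2 ^ Suc j))\<^sup>2 = 4 ^ Suc j"
    unfolding power2_eq_square of_nat_power power_mult_distrib[symmetric] by simp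
  finally have "h * ?m' \<le> 2 * ?d\<^sup>2 * ?q * 4 ^ Suc j * ?m" .
  also have "\<dots> = h * (?m / 2 ^ CARD('d))"
    by (simp add: h_def torsion_const_def power_add)
  finally have "?m' \<le> ?m / 2 ^ CARD('d)" using h by (simp only: mult_le_cancel_left_pos)
  hence "2 ^ CARD('d) * ?m' \<le> ?m" by (simp add: field_simps)
  moreover have "2 * ?m \<le> 2 ^ (Suc j * CARD('d))"
    using Suc.prems(2) unfolding of_nat_le_iff[where 'a = real, symmetric] by simp
  ultimately have "2 ^ CARD('d) * (2 * ?m') \<le> 2 ^ CARD('d) * 2 ^ (j * CARD('d))"
    by (simp only: mult_Suc power_add)
  hence "2 * ?m' \<le> 2 ^ (j * CARD('d))" by (rule mult_left_le_imp_le) simp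
  hence "2 * card {y. u y > k + h} \<le> 2 ^ (j * CARD('d))"
    unfolding of_nat_le_iff[where 'a = real, symmetric] by simp
  hence "u y \<le> k + h + ?K * 4 ^ j" using Suc.IH[of "k + h"] Suc.prems h by simp
  also have "\<dots> \<le> k + ?K * 4 ^ Suc j" using torsion_const_ge_1[where 'd='d] by (simp add: h_def)
  finally show ?case .
qed

text \<open>
  The expectation of the minimum of \<open>n\<close> and the exit time of \<open>W\<close> for the walk started at
  \<open>y\<close>, given by its one-step recursion. The truncation keeps it finite from the outset.
\<close>

primrec truncated_exit_time :: "(int ^ 'd::finite) set \<Rightarrow> nat \<Rightarrow> int ^ 'd \<Rightarrow> real" where
  "truncated_exit_time W 0 y = 0"
| "truncated_exit_time W (Suc n) y = (if y \<in> W then 1 + neighbour_mean (truncated_exit_time W n) y else 0)"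

lemma truncated_exit_time_outside: "y \<notin> W \<Longrightarrow> truncated_exit_time W n y = 0"
  by (cases n) auto

lemma truncated_exit_time_nonneg: "truncated_exit_time W n y \<ge> 0"
proof (induction n arbitrary: y)
  case (Suc n)
  have "neighbour_mean (\<lambda>_. 0) y \<le> neighbour_mean (truncated_exit_time W n) y"
    by (rule neighbour_mean_mono) (rule Suc)
  thus ?case by simp
qed simp

text \<open>
  By monotonicity in the horizon, the recursion turns into the subsolution inequality
  \<open>u \<le> 1 + P u\<close> for a single \<open>n\<close>.
\<close>

lemma truncated_exit_time_mono: "truncated_exit_time W n y \<le> truncated_exit_time W (Suc n) y"
proof (induction n arbitrary: y)
  case (Suc n)
  have "neighbour_mean (truncated_exit_time W n) y \<le> neighbour_mean (truncated_exit_time W (Suc n)) y"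
    by (rule neighbour_mean_mono) (rule Suc)
  thus ?case by simp
qed (use truncated_exit_time_nonneg[of W "Suc 0"] in simp)

lemma truncated_exit_time_le:
  fixes W :: "(int ^ 'd::finite) set"
  assumes "finite W" "2 * card W \<le> 2 ^ (j * CARD('d))"
  shows "truncated_exit_time W n y \<le> torsion_const TYPE('d) * 4 ^ j"
proof -
  have "{y. truncated_exit_time W n y > 0} \<subseteq> W"
  proof
    fix y assume "y \<in> {y. truncated_exit_time W n y > 0}"
    thus "y \<in> W" using truncated_exit_time_outside[of y W n] by (cases "y \<in> W") auto
  qed
  hence "card {y. truncated_exit_time W n y > 0} \<le> card W" using assms(1) by (rule card_mono[rotated])
  hence small: "2 * card {y. truncated_exit_time W n y > 0} \<le> 2 ^ (j * CARD('d))"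
    using assms(2) by linarith
  have sub: "truncated_exit_time W n y \<le> 1 + neighbour_mean (truncated_exit_time W n) y" if "y \<in> W" for y
    using truncated_exit_time_mono[of W n y] that by simp
  have "truncated_exit_time W n y \<le> 0 + torsion_const TYPE('d) * 4 ^ j"
  proof (rule subsolution_bound[OF assms(1)])
    show "truncated_exit_time W n y = 0" if "y \<notin> W" for y
      using that by (rule truncated_exit_time_outside)
  qed (use sub small in auto)
  thus ?thesis by simp
qed

section \<open>Hitting probabilities of the killed walk\<close>

abbreviation step_space :: "(nat \<Rightarrow> int ^ 'd::finite) measure" where
  "step_space \<equiv> (\<Pi>\<^sub>M i\<in>UNIV. measure_pmf step_pmf)"

definition hits_within ::
  "(int ^ 'd) set \<Rightarrow> (int ^ 'd) set \<Rightarrow> nat \<Rightarrow> (nat \<Rightarrow> int ^ 'd) \<Rightarrow> bool" where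
  "hits_within A B n S \<longleftrightarrow> (\<exists>t\<le>n. S t \<in> A \<and> (\<forall>s\<le>t. S s \<notin> B))"

definition hit_prob ::
  "(int ^ 'd::finite) set \<Rightarrow> (int ^ 'd) set \<Rightarrow> nat \<Rightarrow> int ^ 'd \<Rightarrow> real" where
  "hit_prob A B n z = \<P>(S in srw_law z. hits_within A B n S)"

lemma sets_hits_within: "{S \<in> space (srw_law z). hits_within A B n S} \<in> sets (srw_law z)"
proof -
  have [measurable]: "Measurable.pred (\<Pi>\<^sub>M t\<in>UNIV. count_space UNIV) (\<lambda>S. S t \<in> C)" for t :: nat and C :: "(int ^ 'd) set"
    by (rule measurable_compose[OF measurable_component_singleton]) auto
  show ?thesis
    unfolding hits_within_def srw_law_def sets_distr space_distr by measurable
qed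

lemma space_srw_law: "space (srw_law z) = UNIV"
  by (simp add: srw_law_def space_PiM PiE_UNIV_domain)

lemma hits_within_measurable:
  "{\<xi>. hits_within A B n (\<lambda>t. z + (\<Sum>i<t. \<xi> i))} \<in> sets (step_space :: (nat \<Rightarrow> int ^ 'd::finite) measure)"
proof -
  have "{S. hits_within A B n S} \<in> sets (\<Pi>\<^sub>M t\<in>UNIV. count_space (UNIV :: (int ^ 'd) set))"
    using sets_hits_within[of z A B n] by (simp add: space_srw_law) (simp add: srw_law_def)
  from measurable_sets[OF srw_path_measurable this] show ?thesis
    by (simp add: vimage_def space_PiM PiE_UNIV_domain)
qed

lemma hit_prob_eq_step_space:
  "ennreal (hit_prob A B n z) = emeasure step_space {\<xi>. hits_within A B n (\<lambda>t. z + (\<Sum>i<t. \<xi> i))}"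
proof -
  interpret prob_space "srw_law z" by (rule prob_space_srw_law)
  have "ennreal (hit_prob A B n z) = emeasure (srw_law z) {S. hits_within A B n S}"
    by (simp add: hit_prob_def space_srw_law emeasure_eq_measure)
  also have "\<dots> = emeasure step_space ((\<lambda>\<xi> t. z + (\<Sum>i<t. \<xi> i)) -` {S. hits_within A B n S} \<inter> space step_space)"
    unfolding srw_law_def
    by (rule emeasure_distr[OF srw_path_measurable])
      (use sets_hits_within[of z A B n] in \<open>simp add: space_srw_law, simp add: srw_law_def\<close>)
  finally show ?thesis by (simp add: vimage_def space_PiM PiE_UNIV_domain)
qed

lemma hit_prob_nonneg: "hit_prob A B n z \<ge> 0"
  by (simp add: hit_prob_def)

lemma hit_prob_le_1: "hit_prob A B n z \<le> 1"
proof -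
  interpret prob_space "srw_law z" by (rule prob_space_srw_law)
  show ?thesis by (simp add: hit_prob_def)
qed

text \<open>
  The Markov property at time one. A walk that starts outside \<open>A\<close> can hit \<open>A\<close> only after the
  first step, and the increments after the first one have the same product law as the whole
  sequence (\<open>PiM_iter\<close>).
\<close>

lemma hit_prob_Suc_le:
  fixes z :: "int ^ 'd::finite"
  assumes "z \<notin> A"
  shows "hit_prob A B (Suc n) z \<le> neighbour_mean (hit_prob A B n) z"
proof -
  let ?M = "measure_pmf (step_pmf :: (int ^ 'd) pmf)"
  interpret sequence_space ?M by unfold_locales
  let ?X = "\<lambda>n z. {\<xi>. hits_within A B n (\<lambda>t. z + (\<Sum>i<t. \<xi> i))}"
  let ?E = "unit_steps :: (int ^ 'd) set"
  have q: "real (card ?E) > 0" using card_unit_steps_pos by simp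
  have shift: "\<omega> \<in> ?X n (z + s)" if "case_nat s \<omega> \<in> ?X (Suc n) z" for s \<omega>
  proof -
    have path: "z + (\<Sum>i<Suc t. case_nat s \<omega> i) = z + s + (\<Sum>i<t. \<omega> i)" for t
      by (subst sum.lessThan_Suc_shift) (simp add: add.assoc)
    from that obtain t where t: "t \<le> Suc n" "z + (\<Sum>i<t. case_nat s \<omega> i) \<in> A"
      "\<And>s'. s' \<le> t \<Longrightarrow> z + (\<Sum>i<s'. case_nat s \<omega> i) \<notin> B"
      by (auto simp: hits_within_def)
    from t(2) assms obtain t' where t': "t = Suc t'" by (cases t) auto
    have "z + s + (\<Sum>i<t'. \<omega> i) \<in> A" using t(2) unfolding t' path .
    moreover have "z + s + (\<Sum>i<s'. \<omega> i) \<notin> B" if "s' \<le> t'" for s'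
      using t(3)[of "Suc s'"] that unfolding t' path by simp
    ultimately show ?thesis using t(1) t' by (auto simp: hits_within_def)
  qed
  have meas: "(\<lambda>(s, \<omega>). case_nat s \<omega>) \<in> ?M \<Otimes>\<^sub>M S \<rightarrow>\<^sub>M S"
    by measurable
  have "ennreal (hit_prob A B (Suc n) z) = emeasure S (?X (Suc n) z)"
    by (rule hit_prob_eq_step_space)
  also have "\<dots> = emeasure (distr (?M \<Otimes>\<^sub>M S) S (\<lambda>(s, \<omega>). case_nat s \<omega>)) (?X (Suc n) z)"
    by (simp only: PiM_iter)
  also have "\<dots> = emeasure (?M \<Otimes>\<^sub>M S) ((\<lambda>(s, \<omega>). case_nat s \<omega>) -` ?X (Suc n) z \<inter> space (?M \<Otimes>\<^sub>M S))"
    by (rule emeasure_distr[OF meas hits_within_measurable])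
  also have "\<dots> = (\<integral>\<^sup>+s. emeasure S (Pair s -` ((\<lambda>(s, \<omega>). case_nat s \<omega>) -` ?X (Suc n) z \<inter> space (?M \<Otimes>\<^sub>M S))) \<partial>?M)"
    by (rule P.emeasure_pair_measure_alt[OF measurable_sets[OF meas hits_within_measurable]])
  also have "\<dots> \<le> (\<integral>\<^sup>+s. ennreal (hit_prob A B n (z + s)) \<partial>?M)"
  proof (rule nn_integral_mono)
    fix s :: "int ^ 'd"
    have "Pair s -` ((\<lambda>(s, \<omega>). case_nat s \<omega>) -` ?X (Suc n) z \<inter> space (?M \<Otimes>\<^sub>M S)) \<subseteq> ?X n (z + s)"
      by (intro subsetI shift) simp
    thus "emeasure S (Pair s -` ((\<lambda>(s, \<omega>). case_nat s \<omega>) -` ?X (Suc n) z \<inter> space (?M \<Otimes>\<^sub>M S)))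
        \<le> ennreal (hit_prob A B n (z + s))"
      unfolding hit_prob_eq_step_space by (rule emeasure_mono[OF _ hits_within_measurable])
  qed
  also have "\<dots> = (\<Sum>e\<in>?E. ennreal (hit_prob A B n (z + e))) / ennreal (real (card ?E))"
    unfolding step_pmf_def unit_steps_def
    by (subst nn_integral_pmf_of_set[OF unit_steps_nonempty finite_unit_steps])
      (simp add: ennreal_of_nat_eq_real_of_nat)
  also have "\<dots> = ennreal (neighbour_mean (hit_prob A B n) z)"
    using q by (simp add: neighbour_mean_def sum_ennreal hit_prob_nonneg divide_ennreal sum_nonneg)
  finally show ?thesis
    by (simp add: neighbour_mean_def hit_prob_nonneg sum_nonneg)
qed

lemma hit_prob_0: "z \<notin> A \<Longrightarrow> hit_prob A B 0 z = 0"
proof -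
  assume "z \<notin> A"
  hence "ennreal (hit_prob A B 0 z) = 0"
    unfolding hit_prob_eq_step_space by (simp add: hits_within_def)
  thus ?thesis using hit_prob_nonneg[of A B 0 z] by simp
qed

lemma hit_prob_killed: "z \<in> B \<Longrightarrow> hit_prob A B n z = 0"
proof -
  assume z: "z \<in> B"
  have "\<not> hits_within A B n S" if "S 0 \<in> B" for S
    unfolding hits_within_def using that le0 by blast
  hence "{\<xi>. hits_within A B n (\<lambda>t. z + (\<Sum>i<t. \<xi> i))} = {}"
    using z by simp
  hence "ennreal (hit_prob A B n z) = 0"
    unfolding hit_prob_eq_step_space by simp
  thus ?thesis using hit_prob_nonneg[of A B n z] by simp
qed

lemma hitting_prob_le_of_hit_prob_le:
  assumes "\<And>n. hit_prob A B n z \<le> c"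
  shows "\<P>(S in srw_law z. hitting_time A S < hitting_time B S) \<le> c"
proof -
  interpret prob_space "srw_law z" by (rule prob_space_srw_law)
  let ?H = "\<lambda>n. {S \<in> space (srw_law z). hits_within A B n S}"
  have mono: "hits_within A B m S" if "hits_within A B n S" "n \<le> m" for m n S
    using that unfolding hits_within_def by (meson order_trans)
  have "incseq ?H" by (rule monoI) (use mono in blast)
  hence "(\<lambda>n. prob (?H n)) \<longlonglongrightarrow> prob (\<Union>n. ?H n)"
    by (intro finite_Lim_measure_incseq) (use sets_hits_within in blast)
  moreover have "hitting_time A S < hitting_time B S \<longleftrightarrow> (\<exists>n. hits_within A B n S)" for S
    unfolding hitting_time_less_iff hits_within_def by blast
  hence "(\<Union>n. ?H n) = {S \<in> space (srw_law z). hitting_time A S < hitting_time B S}"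
    by simp blast
  ultimately have "(\<lambda>n. hit_prob A B n z) \<longlonglongrightarrow> \<P>(S in srw_law z. hitting_time A S < hitting_time B S)"
    by (simp add: hit_prob_def)
  thus ?thesis by (rule LIMSEQ_le_const2) (use assms in auto)
qed

section \<open>Crossing a sparse annulus\<close>

definition real_vec :: "int ^ 'd \<Rightarrow> real ^ 'd" where
  "real_vec x = (\<chi> i. real_of_int (x $ i))"

lemma lattice_norm_eq: "lattice_norm x = norm (real_vec x)"
  by (simp add: lattice_norm_def real_vec_def)

lemma real_vec_add: "real_vec (x + y) = real_vec x + real_vec y"
  and real_vec_diff: "real_vec (x - y) = real_vec x - real_vec y"
  and real_vec_minus: "real_vec (- x) = - real_vec x"
  and real_vec_0 [simp]: "real_vec 0 = 0"
  by (simp_all add: real_vec_def vec_eq_iff)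

lemma lattice_norm_step:
  assumes "e \<in> unit_steps"
  shows "lattice_norm (y + e) \<ge> lattice_norm y - 1"
  using norm_diff_ineq[of "real_vec y" "real_vec e"] assms
  by (simp add: lattice_norm_eq real_vec_add unit_steps_def)

text \<open>
  The set of unit steps is symmetric, so the cross terms cancel.
\<close>

lemma neighbour_mean_lattice_norm_sq:
  fixes x y :: "int ^ 'd::finite"
  shows "neighbour_mean (\<lambda>y. (lattice_norm (y - x))\<^sup>2) y = (lattice_norm (y - x))\<^sup>2 + 1"
proof -
  let ?E = "unit_steps :: (int ^ 'd) set" and ?a = "real_vec (y - x)"
  have q: "real (card ?E) > 0" using card_unit_steps_pos by simp
  have "(\<Sum>e\<in>?E. real_vec e) = (\<Sum>e\<in>?E. real_vec (- e))"
    by (rule sum.reindex_bij_witness[where i = uminus and j = uminus])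
       (auto simp: unit_steps_def lattice_norm_eq real_vec_minus)
  hence "(\<Sum>e\<in>?E. real_vec e) = - (\<Sum>e\<in>?E. real_vec e)"
    by (simp add: real_vec_minus sum_negf)
  hence zero: "(\<Sum>e\<in>?E. real_vec e) = 0" by (simp only: eq_neg_iff_add_eq_0 scaleR_2[symmetric]) simp
  have "(\<Sum>e\<in>?E. (lattice_norm (y + e - x))\<^sup>2) = (\<Sum>e\<in>?E. (norm ?a)\<^sup>2 + 2 * (?a \<bullet> real_vec e) + 1)"
  proof (rule sum.cong)
    fix e assume "e \<in> ?E"
    hence "norm (real_vec e) = 1" by (simp add: unit_steps_def lattice_norm_eq)
    moreover have "real_vec (y + e - x) = ?a + real_vec e"
      by (simp add: real_vec_add real_vec_diff)
    ultimately show "(lattice_norm (y + e - x))\<^sup>2 = (norm ?a)\<^sup>2 + 2 * (?a \<bullet> real_vec e) + 1"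
      using dot_norm[of ?a "real_vec e"] by (simp add: lattice_norm_eq field_simps)
  qed simp
  also have "\<dots> = real (card ?E) * ((norm ?a)\<^sup>2 + 1) + 2 * (?a \<bullet> (\<Sum>e\<in>?E. real_vec e))"
    by (simp add: sum.distrib inner_sum_right algebra_simps flip: sum_distrib_left)
  finally show ?thesis using q by (simp add: neighbour_mean_def zero lattice_norm_eq)
qed

text \<open>
  Optional stopping for the martingale \<open>\<parallel>S\<^sub>t - x\<parallel>\<^sup>2 - t\<close>. While the walk is in \<open>W\<close>, the
  mean increase of \<open>\<parallel>\<cdot> - x\<parallel>\<^sup>2\<close> by one is compensated by the decrease of the expected
  remaining time. Thus the right-hand side obeys the recursion of the hitting probability;
  it is nonnegative everywhere and at least \<open>\<alpha>\<close> outside the ball.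
\<close>

lemma hit_prob_le_exit_time:
  fixes A B W :: "(int ^ 'd::finite) set"
  assumes r: "r > 0" and \<alpha>: "\<alpha> \<ge> 0"
    and A: "lattice_ball x r \<inter> A = {}" and B: "lattice_ball x r \<subseteq> W \<union> B"
    and out: "\<And>n y e. y \<in> lattice_ball x r \<Longrightarrow> e \<in> unit_steps \<Longrightarrow> y + e \<notin> lattice_ball x r
      \<Longrightarrow> hit_prob A B n (y + e) \<le> \<alpha>"
    and y: "y \<in> lattice_ball x r"
  shows "hit_prob A B n y \<le> \<alpha> / r\<^sup>2 * ((lattice_norm (y - x))\<^sup>2 + truncated_exit_time W n y)"
  using y
proof (induction n arbitrary: y)
  case 0
  have "y \<notin> A" using 0 A by auto
  hence "hit_prob A B 0 y = 0" by (rule hit_prob_0)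
  thus ?case using \<alpha> by simp
next
  case (Suc n)
  let ?\<phi> = "\<lambda>n y. \<alpha> / r\<^sup>2 * ((lattice_norm (y - x))\<^sup>2 + truncated_exit_time W n y)"
  have \<phi>0: "?\<phi> m z \<ge> 0" for m z
    using \<alpha> truncated_exit_time_nonneg[of W m z] by (intro mult_nonneg_nonneg add_nonneg_nonneg) auto
  show ?case
  proof (cases "y \<in> W")
    case False
    hence "y \<in> B" using B Suc.prems by blast
    hence "hit_prob A B (Suc n) y = 0" by (rule hit_prob_killed)
    thus ?thesis using \<phi>0[where m = "Suc n" and z = y] by linarith
  next
    case True
    have "y \<notin> A" using A Suc.prems by blast
    hence "hit_prob A B (Suc n) y \<le> neighbour_mean (hit_prob A B n) y" by (rule hit_prob_Suc_le)
    also have "\<dots> \<le> neighbour_mean (?\<phi> n) y"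
    proof (rule neighbour_mean_mono)
      fix e :: "int ^ 'd" assume e: "e \<in> unit_steps"
      show "hit_prob A B n (y + e) \<le> ?\<phi> n (y + e)"
      proof (cases "y + e \<in> lattice_ball x r")
        case False
        hence "lattice_norm (y + e - x) \<ge> r" by (simp add: lattice_ball_def not_less)
        hence "r\<^sup>2 \<le> (lattice_norm (y + e - x))\<^sup>2" using r by (intro power_mono) auto
        also have "\<dots> \<le> (lattice_norm (y + e - x))\<^sup>2 + truncated_exit_time W n (y + e)"
          using truncated_exit_time_nonneg by auto
        finally have "\<alpha> / r\<^sup>2 * r\<^sup>2 \<le> ?\<phi> n (y + e)"
          using \<alpha> by (intro mult_left_mono) auto
        moreover have "hit_prob A B n (y + e) \<le> \<alpha>" by (rule out[OF Suc.prems e False])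
        ultimately show ?thesis using r by simp
      qed (rule Suc.IH)
    qed
    also have "\<dots> = neighbour_mean (\<lambda>y. \<alpha> / r\<^sup>2 * (lattice_norm (y - x))\<^sup>2
        + \<alpha> / r\<^sup>2 * truncated_exit_time W n y + 0) y"
      by (simp add: distrib_left)
    also have "\<dots> = \<alpha> / r\<^sup>2 * ((lattice_norm (y - x))\<^sup>2 + 1)
        + \<alpha> / r\<^sup>2 * neighbour_mean (truncated_exit_time W n) y + 0"
      unfolding neighbour_mean_affine neighbour_mean_lattice_norm_sq ..
    also have "\<dots> = ?\<phi> (Suc n) y" using True by (simp add: algebra_simps)
    finally show ?thesis .
  qed
qed

definition annulus :: "real \<Rightarrow> real \<Rightarrow> (int ^ 'd) set" where
  "annulus a b = {y. a \<le> lattice_norm y \<and> lattice_norm y < b}"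

text \<open>
  On its way to \<open>B(0,R)\<close> a walk from outside the annulus meets the thin layer
  \<open>t - r - 1 \<le> \<parallel>x\<parallel> < t - r\<close>, as a step lowers the norm by at most one. The ball of radius \<open>r\<close>
  around a site \<open>x\<close> of this layer lies in the annulus, so its sites outside \<open>V\<close> are
  forbidden, and a step that leaves it ends where the bound \<open>\<alpha>\<close> applies. The
  bound \<open>hit_prob_le_exit_time\<close> at the centre of the ball gives the factor \<open>\<beta>\<close>.
\<close>

lemma hit_prob_across_annulus:
  fixes V :: "(int ^ 'd::finite) set" and R :: real
  defines "f \<equiv> hit_prob (lattice_ball 0 R) (shell R - V)"
  assumes r: "r \<ge> 2" and t: "R \<le> t - 3 * r" "t \<le> 2 * R" and \<alpha>: "\<alpha> \<ge> 0" and \<beta>: "\<beta> \<ge> 0"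
    and inner: "\<And>n y. lattice_norm y \<ge> t - 3 * r \<Longrightarrow> f n y \<le> \<alpha>"
    and exit: "\<And>n y. truncated_exit_time (V \<inter> annulus (t - 3 * r) t) n y \<le> \<beta> * r\<^sup>2"
    and y: "lattice_norm y \<ge> t"
  shows "f n y \<le> \<beta> * \<alpha>"
proof -
  let ?W = "V \<inter> annulus (t - 3 * r) t" and ?A = "lattice_ball 0 R :: (int ^ 'd) set"
  have layer: "f n x \<le> \<beta> * \<alpha>" if x: "t - r - 1 \<le> lattice_norm x" "lattice_norm x < t - r" for n x
  proof -
    have near: "t - 2 * r - 1 < lattice_norm w \<and> lattice_norm w < t" if "w \<in> lattice_ball x r" for w
      using that x norm_triangle_ineq3[of "real_vec w" "real_vec x"]
      by (simp add: lattice_ball_def lattice_norm_eq real_vec_diff abs_less_iff abs_le_iff)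
    have "f n x \<le> \<alpha> / r\<^sup>2 * ((lattice_norm (x - x))\<^sup>2 + truncated_exit_time ?W n x)"
      unfolding f_def
    proof (rule hit_prob_le_exit_time)
      show "lattice_ball x r \<inter> ?A = {}"
      proof (rule equals0I)
        fix w assume "w \<in> lattice_ball x r \<inter> ?A"
        with near[of w] t r show False by (simp add: lattice_ball_def)
      qed
      show "lattice_ball x r \<subseteq> ?W \<union> (shell R - V)"
      proof
        fix w assume "w \<in> lattice_ball x r"
        from near[OF this] t r show "w \<in> ?W \<union> (shell R - V)"
          by (auto simp: annulus_def shell_def lattice_ball_def)
      qed
      fix m w e assume w: "w \<in> lattice_ball x r" and e: "(e :: int ^ 'd) \<in> unit_steps"
      have "lattice_norm (w + e) \<ge> t - 3 * r"
        using near[OF w] lattice_norm_step[OF e, of w] r by linarith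
      thus "hit_prob ?A (shell R - V) m (w + e) \<le> \<alpha>" using inner by (simp add: f_def)
    qed (use r \<alpha> in \<open>auto simp: lattice_ball_def lattice_norm_eq\<close>)
    also have "\<dots> \<le> \<alpha> / r\<^sup>2 * (\<beta> * r\<^sup>2)"
      using exit[of n x] \<alpha> by (intro mult_left_mono) (auto simp: lattice_norm_eq)
    also have "\<dots> = \<beta> * \<alpha>" using r by simp
    finally show ?thesis .
  qed
  have "f n y \<le> \<beta> * \<alpha>" if "lattice_norm y \<ge> t - r - 1" for y
    using that
  proof (induction n arbitrary: y)
    case 0
    have "y \<notin> ?A" using 0 t r by (simp add: lattice_ball_def)
    thus ?case using \<alpha> \<beta> by (simp add: f_def hit_prob_0)
  next
    case (Suc n)
    show ?case
    proof (cases "lattice_norm y < t - r")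
      case False
      have "y \<notin> ?A" using False t r by (simp add: lattice_ball_def)
      hence "f (Suc n) y \<le> neighbour_mean (f n) y" unfolding f_def by (rule hit_prob_Suc_le)
      also have "\<dots> \<le> \<beta> * \<alpha>"
      proof (rule neighbour_mean_le_const)
        fix e :: "int ^ 'd" assume "e \<in> unit_steps"
        from lattice_norm_step[OF this, of y] False show "f n (y + e) \<le> \<beta> * \<alpha>"
          by (intro Suc.IH) linarith
      qed
      finally show ?thesis .
    qed (use layer Suc.prems in auto)
  qed
  thus ?thesis using y r by simp
qed

lemma finite_lattice_ball: "finite (lattice_ball 0 r :: (int ^ 'd::finite) set)"
proof (rule finite_subset)
  let ?c = "\<lceil>r\<rceil>"
  show "lattice_ball 0 r \<subseteq> (vec_lambda ` (UNIV \<rightarrow>\<^sub>E {-?c..?c}) :: (int ^ 'd) set)"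
  proof
    fix y :: "int ^ 'd" assume "y \<in> lattice_ball 0 r"
    hence n: "norm (real_vec y) < r" by (simp add: lattice_ball_def lattice_norm_eq)
    have "y $ i \<in> {-?c..?c}" for i
    proof -
      have "\<bar>real_of_int (y $ i)\<bar> < r"
        using component_le_norm_cart[of "real_vec y" i] n by (simp add: real_vec_def)
      thus ?thesis by (simp add: abs_less_iff) linarith
    qed
    hence "vec_nth y \<in> UNIV \<rightarrow>\<^sub>E {-?c..?c}" by auto
    thus "y \<in> vec_lambda ` (UNIV \<rightarrow>\<^sub>E {-?c..?c})" by (metis image_eqI vec_nth_inverse)
  qed
qed (intro finite_imageI finite_PiE; simp)

lemma finite_shell: "finite (shell R :: (int ^ 'd::finite) set)"
  unfolding shell_def using finite_lattice_ball by blast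

definition sub_annulus :: "real \<Rightarrow> real \<Rightarrow> nat \<Rightarrow> (int ^ 'd) set" where
  "sub_annulus R r k = annulus (2 * R - 3 * r * real k - 3 * r) (2 * R - 3 * r * real k)"

lemma disjoint_sub_annuli:
  assumes "r > 0" "i \<noteq> k"
  shows "sub_annulus R r i \<inter> sub_annulus R r k = {}"
proof -
  have less: "sub_annulus R r i \<inter> sub_annulus R r k = {}" if "i < k" for i k
  proof -
    have "3 * r * (real i + 1) \<le> 3 * r * real k" using that assms(1) by (intro mult_left_mono) auto
    thus ?thesis by (auto simp: sub_annulus_def annulus_def algebra_simps)
  qed
  from assms(2) consider "i < k" | "k < i" by linarith
  thus ?thesis using less[of i k] less[of k i] by cases (simp_all add: Int_commute)
qed

text \<open>
  The bound for the annuli with indices at least \<open>k\<close>, which lie innermost, is carried outwards by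
  decreasing \<open>k\<close>; annuli outside \<open>G\<close> cost nothing.
\<close>

lemma hit_prob_le_half_power:
  fixes V :: "(int ^ 'd::finite) set"
  assumes r: "r \<ge> 2" and N: "3 * r * real N \<le> R"
    and good: "\<And>k n y. k \<in> G \<Longrightarrow> truncated_exit_time (V \<inter> sub_annulus R r k) n y \<le> 1 / 2 * r\<^sup>2"
    and G: "G \<subseteq> {..<N}" and z: "lattice_norm z \<ge> 2 * R"
  shows "hit_prob (lattice_ball 0 R) (shell R - V) n z \<le> (1 / 2) ^ card G"
proof -
  let ?f = "hit_prob (lattice_ball 0 R) (shell R - V)"
  let ?t = "\<lambda>k. 2 * R - 3 * r * real k"
  have "\<forall>n y. lattice_norm y \<ge> ?t k \<longrightarrow> ?f n y \<le> (1 / 2) ^ card (G \<inter> {k..})" if "k \<le> N" for k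
    using that
  proof (induction k rule: inc_induct)
    case base
    have "G \<inter> {N..} = {}" using G by auto
    thus ?case by (simp add: hit_prob_le_1)
  next
    case (step k)
    have t: "?t k - 3 * r = ?t (Suc k)" by (simp add: algebra_simps)
    show ?case
    proof (cases "k \<in> G")
      case True
      have "G \<inter> {k..} = insert k (G \<inter> {Suc k..})" using True by (auto simp: Suc_le_eq)
      moreover have "finite (G \<inter> {Suc k..})" using G finite_subset by blast
      ultimately have card: "card (G \<inter> {k..}) = Suc (card (G \<inter> {Suc k..}))" by simp
      have "3 * r * real (Suc k) \<le> 3 * r * real N" using step r by (intro mult_left_mono) auto
      hence inside: "R \<le> ?t k - 3 * r" using N unfolding t by linarith
      have "?f n y \<le> 1 / 2 * (1 / 2) ^ card (G \<inter> {Suc k..})" if "lattice_norm y \<ge> ?t k" for n y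
      proof (rule hit_prob_across_annulus[OF r inside _ _ _ _ _ that])
        show "truncated_exit_time (V \<inter> annulus (?t k - 3 * r) (?t k)) n y \<le> 1 / 2 * r\<^sup>2" for n y
          using good[OF True, of n y] unfolding sub_annulus_def .
      qed (use step.IH r in \<open>simp_all only: t, auto\<close>)
      thus ?thesis by (simp add: card)
    next
      case False
      have "G \<inter> {k..} = G \<inter> {Suc k..}"
        using False by (auto simp: Suc_le_eq) (metis le_neq_implies_less)
      moreover have "?t (Suc k) \<le> ?t k" using r by (simp add: algebra_simps)
      ultimately show ?thesis using step.IH by (metis order_trans)
    qed
  qed
  from this[of 0] z show ?thesis by simp
qed

text \<open>
  An annulus free of \<open>V\<close> cannot be crossed. This is the crossing bound for the empty set, whose
  exit time is zero. It serves when \<open>\<rho>\<close> is small, where no fixed factor per annulus would give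
  the rate \<open>R / \<rho>\<close>.
\<close>

lemma hit_prob_eq_0_if_gap:
  fixes V :: "(int ^ 'd::finite) set"
  assumes r: "r \<ge> 2" and k: "3 * r * real (Suc k) \<le> R" and gap: "V \<inter> sub_annulus R r k = {}"
    and z: "lattice_norm z \<ge> 2 * R"
  shows "hit_prob (lattice_ball 0 R) (shell R - V) n z = 0"
proof -
  let ?t = "2 * R - 3 * r * real k"
  have "hit_prob (lattice_ball 0 R) (shell R - V) n z \<le> 0 * 1"
  proof (rule hit_prob_across_annulus[OF r, of R ?t 1 0])
    show "R \<le> ?t - 3 * r" using k by (simp add: algebra_simps)
    have "3 * r * real k \<ge> 0" using r by simp
    thus "?t \<le> 2 * R" "?t \<le> lattice_norm z" using z by linarith+
    have "truncated_exit_time {} n y \<le> 0" for n and y :: "int ^ 'd" by (cases n) auto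
    thus "truncated_exit_time (V \<inter> annulus (?t - 3 * r) ?t) n y \<le> 0 * r\<^sup>2" for n y
      using gap by (simp add: sub_annulus_def)
  qed (simp_all add: hit_prob_le_1)
  thus ?thesis using hit_prob_nonneg[of "lattice_ball 0 R" "shell R - V" n z] by simp
qed

section \<open>Counting sparse annuli\<close>

lemma card_crowded_le:
  fixes A :: "'a \<Rightarrow> 'b set"
  assumes V: "finite V" and I: "finite I"
    and disj: "\<And>i k. i \<in> I \<Longrightarrow> k \<in> I \<Longrightarrow> i \<noteq> k \<Longrightarrow> A i \<inter> A k = {}"
  shows "card {k \<in> I. m < 2 * card (V \<inter> A k)} * m \<le> 2 * card V"
proof -
  let ?B = "{k \<in> I. m < 2 * card (V \<inter> A k)}"
  have "card ?B * m \<le> (\<Sum>k\<in>?B. 2 * card (V \<inter> A k))"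
    using sum_bounded_below[of ?B m "\<lambda>k. 2 * card (V \<inter> A k)"] by auto
  also have "\<dots> = 2 * card (\<Union>k\<in>?B. V \<inter> A k)"
    by (subst card_UN_disjoint) (use V I disj in \<open>auto simp: sum_distrib_left\<close>)
  also have "\<dots> \<le> 2 * card V"
    by (intro mult_left_mono card_mono V) auto
  finally show ?thesis .
qed

text \<open>
  There are at least \<open>R / (6r)\<close> annuli. A crowded one uses more than \<open>2\<^sup>j\<^sup>d / 2\<close> sites of
  \<open>V\<close>, and \<open>|V| = R \<rho>\<^sup>d\<^sup>-\<^sup>1\<close> with \<open>2\<^sup>j \<ge> 24 r\<^sub>0 \<rho>\<close>. Writing
  \<open>2\<^sup>j\<^sup>d = 2\<^sup>j (2\<^sup>j)\<^sup>d\<^sup>-\<^sup>1\<close> and using \<open>d \<ge> 2\<close> shows that at most \<open>R / (12r)\<close> are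
  crowded.
\<close>

lemma many_uncrowded_sub_annuli:
  fixes V :: "(int ^ 'd::finite) set" and R \<rho> r r0 :: real and j N :: nat
  assumes r_def: "r = 2 ^ j * r0" and N_def: "N = nat \<lfloor>R / (3 * r)\<rfloor>" and d: "CARD('d) \<ge> 2" and r0: "r0 \<ge> 1" and V: "finite V"
    and \<rho>: "\<rho> > 0" "\<rho> ^ (CARD('d) - 1) = real (card V) / R"
    and R: "R \<ge> 3 * r" and j: "24 * r0 * \<rho> \<le> 2 ^ j"
  shows "R / (12 * r) \<le> real (card {k\<in>{..<N}. 2 * card (V \<inter> sub_annulus R r k) \<le> 2 ^ (j * CARD('d))})"
proof -
  let ?G = "{k\<in>{..<N}. 2 * card (V \<inter> sub_annulus R r k) \<le> 2 ^ (j * CARD('d))}"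
  let ?B = "{k\<in>{..<N}. 2 ^ (j * CARD('d)) < 2 * card (V \<inter> sub_annulus R r k)}"
  define p where "p = CARD('d) - 1"
  have p: "CARD('d) = Suc p" "p \<ge> 1" using d by (auto simp: p_def)
  have r: "r > 0" using r0 by (simp add: r_def)
  have R0: "R > 0" using R r by linarith
  have x: "R / (3 * r) \<ge> 1" using R r by simp
  hence "\<lfloor>R / (3 * r)\<rfloor> \<ge> 1" by simp
  hence "real N = of_int \<lfloor>R / (3 * r)\<rfloor>" by (simp add: N_def)
  moreover have "R / (6 * r) = R / (3 * r) / 2" by simp
  ultimately have N: "real N \<ge> R / (6 * r)"
    using \<open>\<lfloor>R / (3 * r)\<rfloor> \<ge> 1\<close> by linarith
  have "card ?B * 2 ^ (j * CARD('d)) \<le> 2 * card V"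
    by (rule card_crowded_le[OF V]) (use disjoint_sub_annuli[OF r] in auto)
  hence "real (card ?B * 2 ^ (j * CARD('d))) \<le> real (2 * card V)" by (rule of_nat_mono)
  hence "real (card ?B) * 2 ^ (j * CARD('d)) \<le> 2 * (R * \<rho> ^ p)"
    using \<rho>(2) R0 by (simp add: p_def)
  also have "(2::real) ^ (j * CARD('d)) = 2 ^ j * (2 ^ j) ^ p"
    by (simp add: p(1) power_mult power_add)
  finally have "real (card ?B) * (2 ^ j * (2 ^ j) ^ p) \<le> 2 * (R * \<rho> ^ p)" .
  \<comment> \<open>As \<open>d \<ge> 2\<close>, the constant \<open>24 r\<^sub>0 \<ge> 1\<close> is raised to a power \<open>p \<ge> 1\<close> and does not decrease.\<close>
  moreover have "24 * r0 * \<rho> ^ p \<le> (2 ^ j) ^ p"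
  proof -
    have "(24 * r0) ^ 1 \<le> (24 * r0) ^ p" using r0 p by (intro power_increasing) auto
    hence "24 * r0 * \<rho> ^ p \<le> (24 * r0) ^ p * \<rho> ^ p" using \<rho>(1) by (intro mult_right_mono) auto
    also have "\<dots> \<le> (2 ^ j) ^ p"
      unfolding power_mult_distrib[symmetric] using j \<rho>(1) r0 by (intro power_mono) auto
    finally show ?thesis .
  qed
  hence "real (card ?B) * (2 ^ j * (24 * r0 * \<rho> ^ p)) \<le> real (card ?B) * (2 ^ j * (2 ^ j) ^ p)"
    by (intro mult_left_mono) auto
  ultimately have "real (card ?B) * (2 ^ j * (24 * r0 * \<rho> ^ p)) \<le> 2 * (R * \<rho> ^ p)" by linarith
  hence "(24 * r * real (card ?B)) * \<rho> ^ p \<le> (2 * R) * \<rho> ^ p" by (simp add: r_def algebra_simps)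
  hence "24 * r * real (card ?B) \<le> 2 * R" using \<rho>(1) by (simp add: mult_le_cancel_right)
  hence B: "real (card ?B) \<le> R / (12 * r)" using r by (simp add: field_simps)
  have "{..<N} = ?G \<union> ?B" by auto
  hence "N = card (?G \<union> ?B)" by (metis card_lessThan)
  also have "\<dots> = card ?G + card ?B" by (rule card_Un_disjoint) auto
  finally have "real N = real (card ?G) + real (card ?B)" by linarith
  moreover have "R / (6 * r) = R / (12 * r) + R / (12 * r)" using r by (simp add: field_simps)
  ultimately show ?thesis using N B by linarith
qed


lemma exists_dyadic_scale:
  fixes x :: real
  assumes "x > 1"
  obtains j :: nat where "x \<le> 2 ^ j" "2 ^ j \<le> 2 * x"
proof -
  define j where "j = (LEAST j. x \<le> 2 ^ j)"
  obtain n where "x < 2 ^ n" using real_arch_pow[of 2 x] by auto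
  hence j: "x \<le> 2 ^ j" unfolding j_def by (intro LeastI[of "\<lambda>j. x \<le> 2 ^ j" n]) auto
  with assms have "j \<noteq> 0" by (intro notI) simp
  then obtain i where i: "j = Suc i" by (cases j) auto
  hence "\<not> x \<le> 2 ^ i" using not_less_Least[of i "\<lambda>j. x \<le> 2 ^ j"] by (simp add: j_def)
  with j i show ?thesis by (intro that[of j]) auto
qed

text \<open>
  The scale \<open>2\<^sup>j\<close> is taken comparable to \<open>M \<rho>\<close>, or equal to one if \<open>M \<rho> \<le> 1\<close>. In the
  first case each sparse annulus contributes a factor \<open>1/2\<close>. In the second, a sparse annulus
  has less than one site of \<open>V\<close>, and the probability is zero. The threshold \<open>T\<close> on \<open>R / \<rho>\<close>
  ensures that at least one annulus fits into the shell; below it the bound is at least one.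
\<close>

theorem lemma1p6:
  assumes "CARD('d::finite) \<ge> 2"
  shows "\<exists>\<kappa> a :: real. \<kappa> > 0 \<and> a > 0 \<and>
    (\<forall>(R::real) (z :: int ^ 'd) V (\<rho>::real).
       R > 0 \<longrightarrow> z \<in> lattice_boundary (lattice_ball 0 (2 * R)) \<longrightarrow>
       V \<subseteq> shell R \<longrightarrow> V \<noteq> {} \<longrightarrow>
       \<rho> > 0 \<longrightarrow> \<rho> ^ (CARD('d) - 1) = real (card V) / R \<longrightarrow>
       \<P>(S in srw_law z. hitting_time (lattice_ball 0 R) S < hitting_time (shell R - V) S)
         \<le> exp (a - \<kappa> * (R / \<rho>)))"
proof -
  define K where "K = torsion_const TYPE('d)"
  \<comment> \<open>The factor \<open>2\<close> makes \<open>r = 2\<^sup>j r\<^sub>0\<close> satisfy \<open>r\<^sup>2 / 2 \<ge> K 4\<^sup>j\<close> and \<open>r \<ge> 2\<close>.\<close>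
  define r0 where "r0 = 2 * K"
  define M where "M = 24 * r0"
  define \<kappa> where "\<kappa> = ln 2 / (24 * M * r0)"
  \<comment> \<open>The two terms cover \<open>R < 3 r\<close> for \<open>j = 0\<close> and for \<open>2\<^sup>j \<le> 2 M \<rho>\<close>.\<close>
  define T where "T = 9 * r0\<^sup>2 + 6 * M * r0"
  have K: "K \<ge> 1" unfolding K_def by (rule torsion_const_ge_1)
  have r0: "r0 \<ge> 2" and M: "M \<ge> 1" using K by (auto simp: r0_def M_def)
  have \<kappa>: "\<kappa> > 0" using r0 M by (simp add: \<kappa>_def)
  have T: "T > 0" using r0 M by (simp add: T_def add_pos_pos)
  have main: "\<P>(S in srw_law z. hitting_time (lattice_ball 0 R) S < hitting_time (shell R - V) S)
         \<le> exp (\<kappa> * T - \<kappa> * (R / \<rho>))"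
    if R: "R > 0" and z: "z \<in> lattice_boundary (lattice_ball 0 (2 * R))"
      and V: "V \<subseteq> shell R" "V \<noteq> {}" and \<rho>: "\<rho> > 0" "\<rho> ^ (CARD('d) - 1) = real (card V) / R"
    for R \<rho> :: real and z :: "int ^ 'd" and V
  proof (cases "R / \<rho> \<le> T")
    case True
    interpret prob_space "srw_law z" by (rule prob_space_srw_law)
    have "\<kappa> * (R / \<rho>) \<le> \<kappa> * T" using True \<kappa> by (intro mult_left_mono) auto
    hence "1 \<le> exp (\<kappa> * T - \<kappa> * (R / \<rho>))" by simp
    thus ?thesis using prob_le_1 order_trans by blast
  next
    case False
    have finV: "finite V" using V finite_shell finite_subset by blast
    have z2: "lattice_norm z \<ge> 2 * R" using z by (simp add: lattice_boundary_def lattice_ball_def)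
    obtain j :: nat where j: "M * \<rho> \<le> 2 ^ j" "j = 0 \<or> 2 ^ j \<le> 2 * (M * \<rho>)"
    proof (cases "M * \<rho> > 1")
      case True
      then obtain j :: nat where "M * \<rho> \<le> 2 ^ j" "2 ^ j \<le> 2 * (M * \<rho>)" by (rule exists_dyadic_scale)
      thus ?thesis using that by blast
    qed (use that[of 0] in simp)
    define r where "r = 2 ^ j * r0"
    define N where "N = nat \<lfloor>R / (3 * r)\<rfloor>"
    define G where "G = {k\<in>{..<N}. 2 * card (V \<inter> sub_annulus R r k) \<le> 2 ^ (j * CARD('d))}"
    have "1 * 2 \<le> r" unfolding r_def using r0 by (intro mult_mono) auto
    hence r: "r \<ge> 2" by simp
    have R3: "R \<ge> 3 * r"
    proof (rule ccontr)
      assume "\<not> R \<ge> 3 * r"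
      hence less: "R < 3 * r" by simp
      have "R / \<rho> \<le> T"
      proof (cases "j = 0")
        case True
        have "1 * \<rho> \<le> M * \<rho>" using M \<rho>(1) by (intro mult_right_mono) auto
        hence "\<rho> \<le> 1" using j(1) True by simp
        \<comment> \<open>As \<open>V\<close> has a site and \<open>d \<ge> 2\<close>, \<open>\<rho> \<ge> \<rho>\<^sup>d\<^sup>-\<^sup>1 \<ge> 1 / R\<close>, while \<open>R < 3 r\<^sub>0\<close>.\<close>
        hence "\<rho> ^ (CARD('d) - 1) \<le> \<rho> ^ 1" using \<rho>(1) assms by (intro power_decreasing) auto
        moreover have "real (card V) \<ge> 1" using finV V(2) by (simp add: Suc_le_eq card_gt_0_iff)
        ultimately have "1 / R \<le> \<rho>" using \<rho>(2) R by (smt (verit) divide_right_mono power_one_right)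
        hence "R / \<rho> \<le> R * R" using R \<rho>(1) by (simp add: field_simps)
        also have "\<dots> \<le> (3 * r0) * (3 * r0)" using less True R by (intro mult_mono) (auto simp: r_def)
        also have "\<dots> \<le> T" using M r0 by (simp add: T_def power2_eq_square)
        finally show ?thesis .
      next
        case False
        hence "3 * r \<le> 3 * (2 * (M * \<rho>) * r0)" using j(2) r0 by (auto simp: r_def)
        hence "R \<le> (6 * M * r0) * \<rho>" using less by (simp add: algebra_simps)
        hence "R / \<rho> \<le> 6 * M * r0" using \<rho>(1) by (simp add: field_simps)
        also have "\<dots> \<le> T" by (simp add: T_def)
        finally show ?thesis .
      qed
      thus False using False by simp
    qed
    have G: "R / (12 * r) \<le> real (card G)"
      unfolding G_def
      by (rule many_uncrowded_sub_annuli[OF r_def N_def assms _ finV \<rho> R3])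
         (use j(1) r0 in \<open>auto simp: M_def\<close>)
    have N: "3 * r * real N \<le> R"
    proof -
      have "real N \<le> R / (3 * r)" unfolding N_def using R r by (intro of_nat_floor) auto
      thus ?thesis using r by (simp add: field_simps)
    qed
    have GN: "G \<subseteq> {..<N}" by (auto simp: G_def)
    have bound: "hit_prob (lattice_ball 0 R) (shell R - V) n z \<le> exp (- (\<kappa> * (R / \<rho>)))" for n
    proof (cases "j = 0")
      case True
      have "card G > 0" using G R r by (smt (verit) divide_pos_pos of_nat_0_less_iff)
      then obtain k where k: "k \<in> G" by (metis card.empty less_irrefl ex_in_conv)
      hence "card (V \<inter> sub_annulus R r k) = 0" using True by (simp add: G_def)
      hence gap: "V \<inter> sub_annulus R r k = {}" using finV by simp
      have "3 * r * real (Suc k) \<le> 3 * r * real N"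
        using k r GN by (intro mult_left_mono) (auto simp: Suc_le_eq)
      hence "3 * r * real (Suc k) \<le> R" using N by linarith
      from hit_prob_eq_0_if_gap[OF r this gap z2] show ?thesis by simp
    next
      case False
      have half: "truncated_exit_time (V \<inter> sub_annulus R r k) n y \<le> 1 / 2 * r\<^sup>2" if "k \<in> G" for k n y
      proof -
        have "truncated_exit_time (V \<inter> sub_annulus R r k) n y \<le> K * 4 ^ j"
          unfolding K_def by (rule truncated_exit_time_le) (use finV that in \<open>auto simp: G_def\<close>)
        also have "\<dots> \<le> 2 * (K * K) * 4 ^ j"
          using K mult_right_mono[of 1 K K] by (intro mult_right_mono) auto
        also have "(4::real) ^ j = (2 ^ j)\<^sup>2" by (simp add: power2_eq_square flip: power_mult_distrib)
        also have "2 * (K * K) * (2 ^ j)\<^sup>2 = 1 / 2 * r\<^sup>2"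
          by (simp add: r_def r0_def power_mult_distrib power2_eq_square)
        finally show ?thesis .
      qed
      have "hit_prob (lattice_ball 0 R) (shell R - V) n z \<le> (1 / 2) ^ card G"
        by (rule hit_prob_le_half_power[OF r N half GN z2])
      also have "\<dots> = exp (- (ln 2 * real (card G)))"
        by (simp add: exp_minus power_one_over inverse_eq_divide exp_of_nat_mult mult.commute)
      also have "\<dots> \<le> exp (- (\<kappa> * (R / \<rho>)))"
      proof -
        have "12 * r \<le> 24 * M * r0 * \<rho>" using j(2) False r0 by (simp add: r_def algebra_simps)
        hence "R / (24 * M * r0 * \<rho>) \<le> R / (12 * r)"
          using R r M r0 \<rho>(1) by (intro divide_left_mono mult_pos_pos) auto
        with G have "ln 2 * (R / (24 * M * r0 * \<rho>)) \<le> ln 2 * real (card G)"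
          by (intro mult_left_mono) auto
        thus ?thesis by (simp add: \<kappa>_def)
      qed
      finally show ?thesis .
    qed
    have "\<P>(S in srw_law z. hitting_time (lattice_ball 0 R) S < hitting_time (shell R - V) S)
        \<le> exp (- (\<kappa> * (R / \<rho>)))"
      by (rule hitting_prob_le_of_hit_prob_le) (rule bound)
    also have "\<dots> \<le> exp (\<kappa> * T - \<kappa> * (R / \<rho>))" using \<kappa> T by simp
    finally show ?thesis .
  qed
  have "\<kappa> * T > 0" using \<kappa> T by simp
  with \<kappa> main show ?thesis by blast
qed

end
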